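(* Let $i<j<k$ be indices in $\{1,\dots,n\}$ and consider the following inequalities in $(x,Y)$: (T13) $u_iY_{jk} -u_iu_kx_j - u_i\ell_jx_k + u_i\ell_ju_k \leq 0$; (T14) $u_kY_{ij} - u_iu_kx_j - \ell_ju_kx_i + u_i\ell_ju_k \leq 0$; (T15) $(u_i - \ell_i)Y_{jk} + \ell_jY_{ik} +u_k(\ell_i -u_i)x_j - \ell_ju_kx_i - u_i\ell_jx_k + u_i\ell_ju_k\leq 0$; (T16) $(u_k -\ell_k)Y_{ij} + \ell_jY_{ik} +u_i(\ell_k -u_k)x_j - \ell_ju_kx_i - u_i\ell_jx_k + u_i\ell_ju_k \leq 0$; (T17) $(u_k - \ell_k) Y_{ij} + u_iY_{jk} + (\ell_j - u_j) Y_{ik} -u_iu_kx_j +(u_j\ell_k - \ell_ju_k)x_i - u_i\ell_jx_k + u_i\ell_ju_k \leq 0$; (T18) $u_kY_{ij} + (u_i - \ell_i) Y_{jk} + (\ell_j - u_j) Y_{ik} -u_iu_kx_j - \ell_ju_kx_i +(\ell_iu_j - u_i\ell_j)x_k + u_i\ell_ju_k \leq 0$. Then (T17) and (T18) cut feasible solutions of $(P_{S_0,\ldots,S_m})$ (that is, each of them is violated by some feasible solution of $(P_{S_0,\ldots,S_m})$), while (T13), (T14), (T15) and (T16) are redundant for $(P_{S_0,\ldots,S_m})$ (that is, they are satisfied by every feasible solution of it).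
   Context: Problem $(P)$ is: minimize $\langle Q_0,xx^T\rangle+c_0^Tx$ over $x\in\mathbb{R}^n$ subject to $\langle Q_r,xx^T\rangle+c_r^Tx\le b_r$ for $r=1,\dots,m$ and $\ell_p\le x_p\le u_p$ for $p=1,\dots,n$. Here $Q_0,\dots,Q_m$ are symmetric $n\times n$ real matrices, $c_0,\dots,c_m\in\mathbb{R}^n$, $b\in\mathbb{R}^m$, $u\in\mathbb{R}^n$, $\ell\in\mathbb{R}_+^n$, the feasible domain of $(P)$ is assumed non-empty, and $\langle A,B\rangle=\sum_{p,q}a_{pq}b_{pq}$. Let $S_0,\dots,S_m$ be any symmetric positive semidefinite $n\times n$ matrices. The convex relaxation $(P_{S_0,\ldots,S_m})$ of $(P)$ is the problem of minimizing $\langle S_0,xx^T\rangle+c_0^Tx+\langle Q_0-S_0,Y\rangle$ over $(x,Y)\in\mathbb{R}^n\times\mathbb{R}^{n\times n}$ subject to: - $\ell_p\le x_p\le u_p$ for all $p$; - $\langle S_r,xx^T\rangle+c_r^Tx+\langle Q_r-S_r,Y\rangle\le b_r$ for $r=1,\dots,m$; - $Y_{qp}=Y_{pq}$ for all $p<q$; - the McCormick inequalities, for all $1\le p\le q\le n$: $Y_{pq}-u_qx_p-\ell_px_q+u_q\ell_p\le 0$, $Y_{pq}-u_px_q-\ell_qx_p+u_p\ell_q\le 0$, $-Y_{pq}+u_qx_p+u_px_q-u_pu_q\le 0$, $-Y_{pq}+\ell_qx_p+\ell_px_q-\ell_p\ell_q\le 0$.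
   Formalization: The claim that (T17) and (T18) cut feasible solutions is false for some instances; it is proved when ℓ ≤ u with ℓ_p < u_p for p = i, j, k, and when all right-hand sides b_r are at least some threshold depending on the other data (no condition on b if m = 0). *)

theory Defs
  imports "HOL-Analysis.Analysis"
begin

text \<open>
  The index set \<open>{1..n}\<close> is an arbitrary finite linearly ordered type \<open>'n\<close>.
  On \<open>'n rmat\<close>, i.e. \<open>real ^ 'n ^ 'n\<close>, the library's inner product \<open>A \<bullet> B\<close> is the sum of
  \<open>A $ p $ q * B $ p $ q\<close> over all \<open>p\<close>, \<open>q\<close>. The data \<open>Q\<close>, \<open>c\<close>, \<open>S\<close> are used
  at the indices \<open>0..m\<close> and \<open>b\<close> at \<open>1..m\<close>; index 0 belongs to the objective
  functions and hence does not occur in the feasible sets.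
\<close>

type_synonym 'n rvec = "(real, 'n) vec"
type_synonym 'n rmat = "((real, 'n) vec, 'n) vec"

definition symmetric_mat :: "('n::finite) rmat \<Rightarrow> bool" where
  "symmetric_mat A \<longleftrightarrow> transpose A = A"

definition psd :: "('n::finite) rmat \<Rightarrow> bool" where
  "psd A \<longleftrightarrow> symmetric_mat A \<and> (\<forall>x. 0 \<le> x \<bullet> (A *v x))"

definition outer :: "('n::finite) rvec \<Rightarrow> 'n rmat" where
  "outer x = (\<chi> p q. x $ p * x $ q)"

definition feasible_P ::
  "nat \<Rightarrow> (nat \<Rightarrow> ('n::finite) rmat) \<Rightarrow> (nat \<Rightarrow> 'n rvec) \<Rightarrow> (nat \<Rightarrow> real) \<Rightarrow>
   'n rvec \<Rightarrow> 'n rvec \<Rightarrow> 'n rvec set" where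
  "feasible_P m Q c b l u =
     {x. (\<forall>r\<in>{1..m}. Q r \<bullet> outer x + c r \<bullet> x \<le> b r) \<and>
         (\<forall>p. l $ p \<le> x $ p \<and> x $ p \<le> u $ p)}"

definition mccormick ::
  "('n::{finite,linorder}) rvec \<Rightarrow> 'n rvec \<Rightarrow> 'n rvec \<Rightarrow> 'n rmat \<Rightarrow> bool" where
  "mccormick l u x Y \<longleftrightarrow>
     (\<forall>p q. p \<le> q \<longrightarrow>
        Y $ p $ q - u $ q * x $ p - l $ p * x $ q + u $ q * l $ p \<le> 0 \<and>
        Y $ p $ q - u $ p * x $ q - l $ q * x $ p + u $ p * l $ q \<le> 0 \<and>
        - (Y $ p $ q) + u $ q * x $ p + u $ p * x $ q - u $ p * u $ q \<le> 0 \<and>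
        - (Y $ p $ q) + l $ q * x $ p + l $ p * x $ q - l $ p * l $ q \<le> 0)"

definition feasible_PS ::
  "nat \<Rightarrow> (nat \<Rightarrow> ('n::{finite,linorder}) rmat) \<Rightarrow> (nat \<Rightarrow> 'n rvec) \<Rightarrow> (nat \<Rightarrow> real) \<Rightarrow>
   'n rvec \<Rightarrow> 'n rvec \<Rightarrow> (nat \<Rightarrow> 'n rmat) \<Rightarrow> ('n rvec \<times> 'n rmat) set" where
  "feasible_PS m Q c b l u S =
     {(x, Y). (\<forall>p. l $ p \<le> x $ p \<and> x $ p \<le> u $ p) \<and>
        (\<forall>r\<in>{1..m}. S r \<bullet> outer x + c r \<bullet> x + (Q r - S r) \<bullet> Y \<le> b r) \<and>
        (\<forall>p q. p < q \<longrightarrow> Y $ q $ p = Y $ p $ q) \<and>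
        mccormick l u x Y}"

text \<open>An inequality is represented by its left-hand side \<open>L\<close>, standing for \<open>L x Y \<le> 0\<close>.\<close>

definition redundant_for :: "('x \<Rightarrow> 'y \<Rightarrow> real) \<Rightarrow> ('x \<times> 'y) set \<Rightarrow> bool" where
  "redundant_for L F \<longleftrightarrow> (\<forall>(x, Y)\<in>F. L x Y \<le> 0)"

definition cuts :: "('x \<Rightarrow> 'y \<Rightarrow> real) \<Rightarrow> ('x \<times> 'y) set \<Rightarrow> bool" where
  "cuts L F \<longleftrightarrow> (\<exists>(x, Y)\<in>F. \<not> L x Y \<le> 0)"

context
  fixes l u :: "('n::finite) rvec" and i j k :: 'n
begin

definition T13 :: "'n rvec \<Rightarrow> 'n rmat \<Rightarrow> real" where
  "T13 x Y = u $ i * Y $ j $ k - u $ i * u $ k * x $ j - u $ i * l $ j * x $ k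
     + u $ i * l $ j * u $ k"

definition T14 :: "'n rvec \<Rightarrow> 'n rmat \<Rightarrow> real" where
  "T14 x Y = u $ k * Y $ i $ j - u $ i * u $ k * x $ j - l $ j * u $ k * x $ i
     + u $ i * l $ j * u $ k"

definition T15 :: "'n rvec \<Rightarrow> 'n rmat \<Rightarrow> real" where
  "T15 x Y = (u $ i - l $ i) * Y $ j $ k + l $ j * Y $ i $ k
     + u $ k * (l $ i - u $ i) * x $ j - l $ j * u $ k * x $ i - u $ i * l $ j * x $ k
     + u $ i * l $ j * u $ k"

definition T16 :: "'n rvec \<Rightarrow> 'n rmat \<Rightarrow> real" where
  "T16 x Y = (u $ k - l $ k) * Y $ i $ j + l $ j * Y $ i $ k
     + u $ i * (l $ k - u $ k) * x $ j - l $ j * u $ k * x $ i - u $ i * l $ j * x $ k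
     + u $ i * l $ j * u $ k"

definition T17 :: "'n rvec \<Rightarrow> 'n rmat \<Rightarrow> real" where
  "T17 x Y = (u $ k - l $ k) * Y $ i $ j + u $ i * Y $ j $ k + (l $ j - u $ j) * Y $ i $ k
     - u $ i * u $ k * x $ j + (u $ j * l $ k - l $ j * u $ k) * x $ i - u $ i * l $ j * x $ k
     + u $ i * l $ j * u $ k"

definition T18 :: "'n rvec \<Rightarrow> 'n rmat \<Rightarrow> real" where
  "T18 x Y = u $ k * Y $ i $ j + (u $ i - l $ i) * Y $ j $ k + (l $ j - u $ j) * Y $ i $ k
     - u $ i * u $ k * x $ j - l $ j * u $ k * x $ i + (l $ i * u $ j - u $ i * l $ j) * x $ k
     + u $ i * l $ j * u $ k"

end

end

theory Submission
  imports Defs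
begin

text \<open>
  Each of (T13)--(T16) is a combination of McCormick over-estimators with coefficients that are
  non-negative because \<open>0 \<le> l \<le> u\<close>; hence it is redundant. For instance (T15) is
  \<open>u i - l i\<close> times an over-estimator of \<open>Y j k\<close> plus \<open>l j\<close> times one of \<open>Y i k\<close>.

  In (T17) and (T18) the product \<open>Y i k\<close> has the negative coefficient \<open>l j - u j\<close>, whereas those
  of \<open>Y i j\<close> and \<open>Y j k\<close> are non-negative. The McCormick inequalities couple no two products, so
  at a given \<open>x\<close> the entries \<open>Y i j\<close> and \<open>Y j k\<close> can be taken as large, and \<open>Y i k\<close> as small, as
  McCormick permits. At the midpoint of the box both left-hand sides then equal half the volume of
  the box spanned by the coordinates \<open>i\<close>, \<open>j\<close>, \<open>k\<close>, which is positive as soon as these three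
  intervals are non-degenerate. This point does not depend on \<open>b\<close>, so it is feasible for all
  sufficiently large \<open>b\<close>.
\<close>

text \<open>
  The two over-estimators of \<open>Y p q\<close> arise from the products
  \<open>(u q - x q) * (x p - l p) \<ge> 0\<close> and \<open>(u p - x p) * (x q - l q) \<ge> 0\<close> when \<open>Y p q\<close> replaces
  \<open>x p * x q\<close>.
\<close>

lemma mccormick_overestimators:
  assumes "mccormick l u x Y" and "p \<le> q"
  shows "Y $ p $ q - u $ q * x $ p - l $ p * x $ q + u $ q * l $ p \<le> 0"
    and "Y $ p $ q - u $ p * x $ q - l $ q * x $ p + u $ p * l $ q \<le> 0"
  using assms unfolding mccormick_def by blast+

lemma feasible_PS_D:
  assumes "(x, Y) \<in> feasible_PS m Q c b l u S"
  shows "mccormick l u x Y" and "l $ p \<le> u $ p"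
  using assms unfolding feasible_PS_def by (auto intro: order_trans)

lemma redundant_T13:
  assumes "\<And>p. 0 \<le> l $ p" and "j < k"
  shows "redundant_for (T13 l u i j k) (feasible_PS m Q c b l u S)"
  unfolding redundant_for_def
proof safe
  fix x Y assume F: "(x, Y) \<in> feasible_PS m Q c b l u S"
  have jk: "Y $ j $ k - u $ k * x $ j - l $ j * x $ k + u $ k * l $ j \<le> 0"
    using mccormick_overestimators(1)[OF feasible_PS_D(1)[OF F]] assms(2) by simp
  have "0 \<le> u $ i"
    using order_trans[OF assms(1) feasible_PS_D(2)[OF F]] .
  from mult_nonneg_nonpos[OF this jk] show "T13 l u i j k x Y \<le> 0"
    unfolding T13_def by (simp add: algebra_simps)
qed

lemma redundant_T14:
  assumes "\<And>p. 0 \<le> l $ p" and "i < j"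
  shows "redundant_for (T14 l u i j k) (feasible_PS m Q c b l u S)"
  unfolding redundant_for_def
proof safe
  fix x Y assume F: "(x, Y) \<in> feasible_PS m Q c b l u S"
  have ij: "Y $ i $ j - u $ i * x $ j - l $ j * x $ i + u $ i * l $ j \<le> 0"
    using mccormick_overestimators(2)[OF feasible_PS_D(1)[OF F]] assms(2) by simp
  have "0 \<le> u $ k"
    using order_trans[OF assms(1) feasible_PS_D(2)[OF F]] .
  from mult_nonneg_nonpos[OF this ij] show "T14 l u i j k x Y \<le> 0"
    unfolding T14_def by (simp add: algebra_simps)
qed

lemma redundant_T15:
  assumes "\<And>p. 0 \<le> l $ p" and "i < j" and "j < k"
  shows "redundant_for (T15 l u i j k) (feasible_PS m Q c b l u S)"
  unfolding redundant_for_def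
proof safe
  fix x Y assume F: "(x, Y) \<in> feasible_PS m Q c b l u S"
  note M = mccormick_overestimators[OF feasible_PS_D(1)[OF F]]
  have jk: "Y $ j $ k - u $ k * x $ j - l $ j * x $ k + u $ k * l $ j \<le> 0"
    using M(1) assms(3) by simp
  have ik: "Y $ i $ k - u $ k * x $ i - l $ i * x $ k + u $ k * l $ i \<le> 0"
    using M(1) assms(2,3) by simp
  have "0 \<le> u $ i - l $ i"
    using feasible_PS_D(2)[OF F] by simp
  from mult_nonneg_nonpos[OF this jk] mult_nonneg_nonpos[OF assms(1)[of j] ik]
  show "T15 l u i j k x Y \<le> 0"
    unfolding T15_def by (simp add: algebra_simps)
qed

lemma redundant_T16:
  assumes "\<And>p. 0 \<le> l $ p" and "i < j" and "j < k"
  shows "redundant_for (T16 l u i j k) (feasible_PS m Q c b l u S)"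
  unfolding redundant_for_def
proof safe
  fix x Y assume F: "(x, Y) \<in> feasible_PS m Q c b l u S"
  note M = mccormick_overestimators[OF feasible_PS_D(1)[OF F]]
  have ij: "Y $ i $ j - u $ i * x $ j - l $ j * x $ i + u $ i * l $ j \<le> 0"
    using M(2) assms(2) by simp
  have ik: "Y $ i $ k - u $ i * x $ k - l $ k * x $ i + u $ i * l $ k \<le> 0"
    using M(2) assms(2,3) by simp
  have "0 \<le> u $ k - l $ k"
    using feasible_PS_D(2)[OF F] by simp
  from mult_nonneg_nonpos[OF this ij] mult_nonneg_nonpos[OF assms(1)[of j] ik]
  show "T16 l u i j k x Y \<le> 0"
    unfolding T16_def by (simp add: algebra_simps)
qed

definition box_midpoint :: "('n::finite) rvec \<Rightarrow> 'n rvec \<Rightarrow> 'n rvec" where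
  "box_midpoint l u = (\<chi> p. (l $ p + u $ p) / 2)"

definition corner_mean_low :: "('n::finite) rvec \<Rightarrow> 'n rvec \<Rightarrow> 'n \<Rightarrow> 'n \<Rightarrow> real" where
  "corner_mean_low l u p q = (l $ p * u $ q + u $ p * l $ q) / 2"

definition corner_mean_high :: "('n::finite) rvec \<Rightarrow> 'n rvec \<Rightarrow> 'n \<Rightarrow> 'n \<Rightarrow> real" where
  "corner_mean_high l u p q = (l $ p * l $ q + u $ p * u $ q) / 2"

text \<open>
  At the midpoint the two over-estimators of \<open>Y p q\<close> coincide, and so do the two
  under-estimators: their values are the means of \<open>x p * x q\<close> over the two diagonals of the
  rectangle of the coordinates \<open>p\<close> and \<open>q\<close>. Between these means \<open>Y p q\<close> is free.
\<close>

lemma mccormick_box_midpoint_iff: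
  "mccormick l u (box_midpoint l u) Y \<longleftrightarrow>
     (\<forall>p q. p \<le> q \<longrightarrow> corner_mean_low l u p q \<le> Y $ p $ q \<and> Y $ p $ q \<le> corner_mean_high l u p q)"
proof -
  have "(Y $ p $ q - u $ q * box_midpoint l u $ p - l $ p * box_midpoint l u $ q + u $ q * l $ p \<le> 0 \<and>
     Y $ p $ q - u $ p * box_midpoint l u $ q - l $ q * box_midpoint l u $ p + u $ p * l $ q \<le> 0 \<and>
     - (Y $ p $ q) + u $ q * box_midpoint l u $ p + u $ p * box_midpoint l u $ q - u $ p * u $ q \<le> 0 \<and>
     - (Y $ p $ q) + l $ q * box_midpoint l u $ p + l $ p * box_midpoint l u $ q - l $ p * l $ q \<le> 0)
     \<longleftrightarrow> corner_mean_low l u p q \<le> Y $ p $ q \<and> Y $ p $ q \<le> corner_mean_high l u p q" for p q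
    unfolding box_midpoint_def corner_mean_low_def corner_mean_high_def
    by (simp add: field_simps) auto
  then show ?thesis
    unfolding mccormick_def by presburger
qed

lemma corner_mean_low_le_high:
  assumes "\<And>p. l $ p \<le> u $ p"
  shows "corner_mean_low l u p q \<le> corner_mean_high l u p q"
proof -
  have "0 \<le> (u $ p - l $ p) * (u $ q - l $ q)"
    using assms by simp
  then show ?thesis
    unfolding corner_mean_low_def corner_mean_high_def by (simp add: algebra_simps)
qed

lemma T17_box_midpoint:
  assumes "Y $ i $ j = corner_mean_high l u i j" and "Y $ j $ k = corner_mean_high l u j k"
    and "Y $ i $ k = corner_mean_low l u i k"
  shows "T17 l u i j k (box_midpoint l u) Y = (u $ i - l $ i) * (u $ j - l $ j) * (u $ k - l $ k) / 2"
  unfolding T17_def assms box_midpoint_def corner_mean_low_def corner_mean_high_def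
  by (simp add: field_simps)

lemma T18_box_midpoint:
  assumes "Y $ i $ j = corner_mean_high l u i j" and "Y $ j $ k = corner_mean_high l u j k"
    and "Y $ i $ k = corner_mean_low l u i k"
  shows "T18 l u i j k (box_midpoint l u) Y = (u $ i - l $ i) * (u $ j - l $ j) * (u $ k - l $ k) / 2"
  unfolding T18_def assms box_midpoint_def corner_mean_low_def corner_mean_high_def
  by (simp add: field_simps)

text \<open>
  Independence of the products: the entry at \<open>{i, k}\<close> goes to its lower bound while all other
  entries, in particular those at \<open>{i, j}\<close> and \<open>{j, k}\<close>, stay at their upper bounds.
\<close>

lemma exists_mccormick_violator:
  fixes l u :: "('n::{finite,linorder}) rvec"
  assumes box: "\<And>p. l $ p \<le> u $ p"
    and strict: "l $ i < u $ i" "l $ j < u $ j" "l $ k < u $ k"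
    and "i < j" "j < k"
  obtains Y where "\<And>p q. Y $ q $ p = Y $ p $ q" and "mccormick l u (box_midpoint l u) Y"
    and "0 < T17 l u i j k (box_midpoint l u) Y" and "0 < T18 l u i j k (box_midpoint l u) Y"
proof -
  define Y :: "'n rmat" where
    "Y = (\<chi> p q. if {p, q} = {i, k} then corner_mean_low l u p q else corner_mean_high l u p q)"
  have Y_ij: "Y $ i $ j = corner_mean_high l u i j" and Y_jk: "Y $ j $ k = corner_mean_high l u j k"
    and Y_ik: "Y $ i $ k = corner_mean_low l u i k"
    using assms(5,6) by (auto simp: Y_def doubleton_eq_iff)
  have pos: "0 < (u $ i - l $ i) * (u $ j - l $ j) * (u $ k - l $ k) / 2"
    using strict by simp
  show ?thesis
  proof
    show "Y $ q $ p = Y $ p $ q" for p q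
      by (simp add: Y_def corner_mean_low_def corner_mean_high_def insert_commute mult.commute)
    show "mccormick l u (box_midpoint l u) Y"
      unfolding mccormick_box_midpoint_iff
      using corner_mean_low_le_high[OF box] by (simp add: Y_def)
    show "0 < T17 l u i j k (box_midpoint l u) Y" "0 < T18 l u i j k (box_midpoint l u) Y"
      using pos by (simp_all only: T17_box_midpoint[OF Y_ij Y_jk Y_ik] T18_box_midpoint[OF Y_ij Y_jk Y_ik])
  qed
qed

theorem proposition3:
  fixes Q S :: "nat \<Rightarrow> ('n::{finite,linorder}) rmat" and c :: "nat \<Rightarrow> 'n rvec"
    and l u :: "'n rvec" and m :: nat and i j k :: 'n
  assumes "\<And>r. r \<le> m \<Longrightarrow> symmetric_mat (Q r)"
    and "\<And>r. r \<le> m \<Longrightarrow> psd (S r)"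
    and "\<And>p. 0 \<le> l $ p"
    and "i < j" and "j < k"
  shows
    "(\<forall>b. feasible_P m Q c b l u \<noteq> {} \<longrightarrow>
        redundant_for (T13 l u i j k) (feasible_PS m Q c b l u S) \<and>
        redundant_for (T14 l u i j k) (feasible_PS m Q c b l u S) \<and>
        redundant_for (T15 l u i j k) (feasible_PS m Q c b l u S) \<and>
        redundant_for (T16 l u i j k) (feasible_PS m Q c b l u S)) \<and>
     ((\<forall>p. l $ p \<le> u $ p) \<and> l $ i < u $ i \<and> l $ j < u $ j \<and> l $ k < u $ k \<longrightarrow>
        (\<exists>b0. \<forall>b. (\<forall>r\<in>{1..m}. b0 r \<le> b r) \<longrightarrow>
           feasible_P m Q c b l u \<noteq> {} \<and>
           cuts (T17 l u i j k) (feasible_PS m Q c b l u S) \<and>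
           cuts (T18 l u i j k) (feasible_PS m Q c b l u S)))"
proof (intro conjI allI impI)
  fix b
  show "redundant_for (T13 l u i j k) (feasible_PS m Q c b l u S)"
    using redundant_T13 assms(3,5) .
  show "redundant_for (T14 l u i j k) (feasible_PS m Q c b l u S)"
    using redundant_T14 assms(3,4) .
  show "redundant_for (T15 l u i j k) (feasible_PS m Q c b l u S)"
    using redundant_T15 assms(3-5) .
  show "redundant_for (T16 l u i j k) (feasible_PS m Q c b l u S)"
    using redundant_T16 assms(3-5) .
next
  assume A: "(\<forall>p. l $ p \<le> u $ p) \<and> l $ i < u $ i \<and> l $ j < u $ j \<and> l $ k < u $ k"
  let ?x = "box_midpoint l u"
  obtain Y where sym: "\<And>p q. Y $ q $ p = Y $ p $ q" and mc: "mccormick l u ?x Y"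
    and T17: "0 < T17 l u i j k ?x Y" and T18: "0 < T18 l u i j k ?x Y"
    using exists_mccormick_violator[of l u i j k] A assms(4,5) by blast
  have box: "l $ p \<le> ?x $ p \<and> ?x $ p \<le> u $ p" for p
    using A by (simp add: box_midpoint_def field_simps)
  \<comment> \<open>The maximum makes the midpoint feasible for the original problem as well.\<close>
  define b0 where "b0 r = max (Q r \<bullet> outer ?x + c r \<bullet> ?x)
    (S r \<bullet> outer ?x + c r \<bullet> ?x + (Q r - S r) \<bullet> Y)" for r
  show "\<exists>b0. \<forall>b. (\<forall>r\<in>{1..m}. b0 r \<le> b r) \<longrightarrow>
      feasible_P m Q c b l u \<noteq> {} \<and>
      cuts (T17 l u i j k) (feasible_PS m Q c b l u S) \<and>
      cuts (T18 l u i j k) (feasible_PS m Q c b l u S)"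
  proof (rule exI[of _ b0], intro allI impI)
    fix b assume b: "\<forall>r\<in>{1..m}. b0 r \<le> b r"
    have "?x \<in> feasible_P m Q c b l u"
      using b box by (simp add: feasible_P_def b0_def)
    moreover have "(?x, Y) \<in> feasible_PS m Q c b l u S"
      using b box sym mc by (simp add: feasible_PS_def b0_def)
    ultimately show "feasible_P m Q c b l u \<noteq> {} \<and>
        cuts (T17 l u i j k) (feasible_PS m Q c b l u S) \<and>
        cuts (T18 l u i j k) (feasible_PS m Q c b l u S)"
      using T17 T18 unfolding cuts_def by (auto simp: not_le)
  qed
qed

end
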